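(* There exist absolute constants $a_0,a_1>0$ such that the following holds for every $N\in\mathbb{N}_0$ and every $\varepsilon\ge 0$. If $K,L\subset[0,1]^2$ are convex bodies satisfying \[\sum_{i,j=0}^N|\mu_{ij}(K)-\mu_{ij}(L)|^2\le\varepsilon^2,\] then \[\delta_N(K,L)\le\min\left\{a_0(n+1)^2e^{7(n+1)}\varepsilon^2+\frac{a_1}{n+1}: n=0,\dots,N\right\}.\]
   Context: A convex body is a compact, convex subset of $\mathbb{R}^2$ with nonempty interior. For a convex body $K\subset[0,1]^2$ and $i,j\in\mathbb{N}_0$, the geometric moment is $\mu_{ij}(K)=\int_K x_1^i x_2^j\,d(x_1,x_2)$. The Nikodym distance $\delta_N(K,L)$ is the area of the symmetric difference $(K\setminus L)\cup(L\setminus K)$ (the subscript in $\delta_N$ stands for Nikodym and is unrelated to the integer $N$). *)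

theory Defs
  imports "HOL-Analysis.Analysis"
begin

definition convex_body :: "(real \<times> real) set \<Rightarrow> bool" where
  "convex_body K \<longleftrightarrow> compact K \<and> convex K \<and> interior K \<noteq> {}"

definition geometric_moment :: "nat \<Rightarrow> nat \<Rightarrow> (real \<times> real) set \<Rightarrow> real" where
  "geometric_moment i j K = set_lebesgue_integral lborel K (\<lambda>x. fst x ^ i * snd x ^ j)"

definition nikodym_dist :: "(real \<times> real) set \<Rightarrow> (real \<times> real) set \<Rightarrow> real" where
  "nikodym_dist K L = measure lborel ((K - L) \<union> (L - K))"

end

theory Submission
  imports Defs
begin

text \<open>
  Let \<open>g = 1\<^sub>K - 1\<^sub>L\<close>, so that \<open>\<integral> g\<^sup>2\<close> is the Nikodym distance. For a nonnegative polynomial \<open>p\<close> of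
  degree at most \<open>n\<close> with \<open>\<integral> p = 1\<close> over \<open>[-1, 1]\<close>, the double integral of
  \<open>p (z\<^sub>1 - w\<^sub>1) p (z\<^sub>2 - w\<^sub>2) g z g w\<close> is a quadratic form in the moments of \<open>g\<close> of order at
  most \<open>n\<close> in each variable, hence at most \<open>\<epsilon>\<^sup>2\<close> times a constant depending on the coefficients of
  \<open>p\<close>. It differs from \<open>\<integral> g\<^sup>2\<close> by an average, with weight \<open>p (v\<^sub>1) p (v\<^sub>2)\<close>, of the translation
  errors \<open>\<integral> \<bar>g z - g (z - v)\<bar>\<close>, which are \<open>O(\<bar>v\<^sub>1\<bar> + \<bar>v\<^sub>2\<bar>)\<close> because axis-parallel slices of convex
  bodies are intervals. Taking for \<open>p\<close> the normalised fourth power of the Dirichlet kernel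
  \<open>sin ((2 m + 1) t) / sin t\<close>, a polynomial in \<open>s = sin t\<close>, makes \<open>\<integral> \<bar>s\<bar> p\<close> of order \<open>1 / n\<close>.
\<close>

section \<open>Polynomial kernels\<close>

text \<open>This is the weighted l1 norm of the coefficients, with weight 2^d in degree d. The point
  2 is chosen because the binomial coefficients of (x - y)^d have absolute sum 2^d.\<close>

definition coeff_norm :: "real poly \<Rightarrow> real" where
  "coeff_norm p = poly (map_poly abs p) 2"

lemma coeff_norm_pCons [simp]: "coeff_norm (pCons a p) = \<bar>a\<bar> + 2 * coeff_norm p"
  by (simp add: coeff_norm_def map_poly_pCons)

lemma coeff_norm_0 [simp]: "coeff_norm 0 = 0"
  by (simp add: coeff_norm_def)

lemma coeff_norm_nonneg [simp]: "coeff_norm p \<ge> 0"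
  by (induction p) auto

lemma coeff_norm_add: "coeff_norm (p + q) \<le> coeff_norm p + coeff_norm q"
  by (induction p q rule: poly_induct2) auto

lemma coeff_norm_smult [simp]: "coeff_norm (smult c p) = \<bar>c\<bar> * coeff_norm p"
  by (induction p) (auto simp: abs_mult algebra_simps)

lemma coeff_norm_diff: "coeff_norm (p - q) \<le> coeff_norm p + coeff_norm q"
  using coeff_norm_add[of p "smult (-1) q"] coeff_norm_smult[of "-1" q] by simp

text \<open>Taking absolute values of coefficients can only destroy cancellation in a product, and
  evaluation at 2 is multiplicative.\<close>

lemma coeff_norm_mult: "coeff_norm (p * q) \<le> coeff_norm p * coeff_norm q"
proof (induction p)
  case (pCons a p)
  have "coeff_norm (pCons a p * q) \<le> coeff_norm (smult a q) + coeff_norm (pCons 0 (p * q))"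
    unfolding mult_pCons_left by (rule coeff_norm_add)
  also have "\<dots> \<le> coeff_norm (pCons a p) * coeff_norm q"
    using pCons.IH by (simp add: algebra_simps)
  finally show ?case .
qed simp

lemma coeff_norm_power: "coeff_norm (p ^ k) \<le> coeff_norm p ^ k"
proof (induction k)
  case (Suc k)
  then show ?case
    using coeff_norm_mult[of p "p ^ k"] mult_left_mono[OF Suc coeff_norm_nonneg[of p]] by simp
qed (simp add: one_pCons)

lemma poly_sum_atMost:
  fixes p :: "'a::comm_semiring_1 poly"
  assumes "degree p \<le> n"
  shows "poly p x = (\<Sum>d\<le>n. coeff p d * x ^ d)"
  unfolding poly_altdef
  using assms by (intro sum.mono_neutral_left) (auto simp: coeff_eq_0)

lemma coeff_norm_altdef:
  assumes "degree p \<le> n"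
  shows "coeff_norm p = (\<Sum>d\<le>n. \<bar>coeff p d\<bar> * 2 ^ d)"
proof -
  have "degree (map_poly abs p) \<le> n"
    using assms by (intro degree_le) (auto simp: coeff_map_poly coeff_eq_0)
  then show ?thesis
    unfolding coeff_norm_def by (simp add: poly_sum_atMost coeff_map_poly)
qed

section \<open>Expansion of a polynomial in a difference\<close>

text \<open>By the binomial theorem this is the coefficient of \<open>x ^ i * y ^ j\<close> in
  \<open>poly p (x - y)\<close>. The argument is a pair so that sums can run over the triangle i + j
  \<le> n.\<close>

definition diff_coeff :: "real poly \<Rightarrow> nat \<times> nat \<Rightarrow> real" where
  "diff_coeff p = (\<lambda>(i, j). coeff p (i + j) * of_nat ((i + j) choose i) * (-1) ^ j)"

lemma poly_diff_expansion:
  assumes "degree p \<le> n"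
  shows "poly p (x - y) = (\<Sum>(i, j)\<in>{(i, j). i + j \<le> n}. diff_coeff p (i, j) * x ^ i * y ^ j)"
proof -
  have "poly p (x - y) = (\<Sum>d\<le>n. coeff p d * (x + - y) ^ d)"
    using assms by (simp add: poly_sum_atMost)
  also have "\<dots> = (\<Sum>d\<le>n. \<Sum>i\<le>d. diff_coeff p (i, d - i) * x ^ i * y ^ (d - i))"
    unfolding binomial_ring sum_distrib_left
    by (intro sum.cong refl) (auto simp: diff_coeff_def power_minus[of y] mult_ac)
  finally show ?thesis
    by (simp add: sum.triangle_reindex_eq)
qed

text \<open>The terms with i + j = d contribute |\<open>coeff p d\<close>| times a full row of
  Pascal's triangle, that is 2^d.\<close>

lemma sum_abs_diff_coeff:
  assumes "degree p \<le> n"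
  shows "(\<Sum>a\<in>{(i, j). i + j \<le> n}. \<bar>diff_coeff p a\<bar>) = coeff_norm p"
proof -
  have "(\<Sum>a\<in>{(i, j). i + j \<le> n}. \<bar>diff_coeff p a\<bar>) = (\<Sum>(i, j)\<in>{(i, j). i + j \<le> n}. \<bar>diff_coeff p (i, j)\<bar>)"
    by (intro sum.cong) auto
  also have "\<dots> = (\<Sum>d\<le>n. \<Sum>i\<le>d. \<bar>diff_coeff p (i, d - i)\<bar>)"
    by (rule sum.triangle_reindex_eq)
  also have "\<dots> = (\<Sum>d\<le>n. \<bar>coeff p d\<bar> * (\<Sum>i\<le>d. of_nat (d choose i)))"
    unfolding sum_distrib_left
    by (intro sum.cong refl) (auto simp: diff_coeff_def abs_mult power_abs)
  also have "\<dots> = (\<Sum>d\<le>n. \<bar>coeff p d\<bar> * 2 ^ d)"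
    by (simp flip: of_nat_sum add: choose_row_sum)
  finally show ?thesis
    using assms by (simp add: coeff_norm_altdef)
qed

section \<open>Chebyshev and Dirichlet polynomials in the sine\<close>

text \<open>With s = sin t this is cos(2 j t), i.e. the Chebyshev polynomial T_j at 1 - 2 s^2. The
  recurrence is the Chebyshev one, with 2 cos(2 t) = 2 - 4 s^2.\<close>

fun cos_poly :: "nat \<Rightarrow> real poly" where
  "cos_poly 0 = 1"
| "cos_poly (Suc 0) = [:1, 0, -2:]"
| "cos_poly (Suc (Suc j)) = [:2, 0, -4:] * cos_poly (Suc j) - cos_poly j"

lemma poly_cos_poly: "poly (cos_poly j) (sin t) = cos (2 * real j * t)"
proof (induction j rule: cos_poly.induct)
  case 2
  then show ?case by (simp add: cos_double_sin power2_eq_square)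
next
  case (3 j)
  have "cos (2 * real (Suc (Suc j)) * t) + cos (2 * real j * t)
      = 2 * cos (2 * t) * cos (2 * real (Suc j) * t)"
    by (simp add: cos_plus_cos algebra_simps add_divide_distrib)
  moreover have "cos (2 * t) = 1 - 2 * (sin t)\<^sup>2"
    by (rule cos_double_sin)
  ultimately show ?case
    using 3 by (simp add: power2_eq_square algebra_simps) algebra
qed simp

lemma degree_cos_poly: "degree (cos_poly j) \<le> 2 * j"
proof (induction j rule: cos_poly.induct)
  case (3 j)
  have "degree ([:2, 0, -4:] * cos_poly (Suc j)) \<le> 2 + 2 * Suc j"
    using degree_mult_le[of "[:2, 0, -4:]" "cos_poly (Suc j)"] 3 by simp
  then show ?case
    using 3 by (auto intro!: degree_diff_le)
qed auto

text \<open>The multiplier 2 - 4 s^2 has norm 2 + 4 * 4 = 18, so the recurrence grows at most like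
  19^j because 18 * 19 + 1 \<le> 19^2.\<close>

lemma coeff_norm_cos_poly: "coeff_norm (cos_poly j) \<le> 19 ^ j"
proof (induction j rule: cos_poly.induct)
  case (3 j)
  have "coeff_norm (cos_poly (Suc (Suc j)))
      \<le> coeff_norm [:2, 0, -4:] * coeff_norm (cos_poly (Suc j)) + coeff_norm (cos_poly j)"
    using coeff_norm_diff[of "[:2, 0, -4:] * cos_poly (Suc j)" "cos_poly j"]
      coeff_norm_mult[of "[:2, 0, -4:]" "cos_poly (Suc j)"]
    by (simp only: cos_poly.simps)
  also have "\<dots> \<le> 18 * 19 ^ Suc j + 19 ^ j"
    using 3 by simp
  also have "\<dots> \<le> 19 ^ Suc (Suc j)"
    by simp
  finally show ?case .
qed (auto simp: one_pCons)

text \<open>The Dirichlet kernel 1 + 2 cos(2 t) + ... + 2 cos(2 m t), written as a polynomial in s =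
  sin t.\<close>

primrec dirichlet_poly :: "nat \<Rightarrow> real poly" where
  "dirichlet_poly 0 = 1"
| "dirichlet_poly (Suc m) = dirichlet_poly m + smult 2 (cos_poly (Suc m))"

lemma degree_dirichlet_poly: "degree (dirichlet_poly m) \<le> 2 * m"
proof (induction m)
  case (Suc m)
  have "degree (smult 2 (cos_poly (Suc m))) \<le> 2 * Suc m"
    using degree_cos_poly[of "Suc m"] by simp
  then show ?case
    using Suc by (auto intro!: degree_add_le)
qed simp

lemma coeff_norm_dirichlet_poly: "coeff_norm (dirichlet_poly m) \<le> 3 * 19 ^ m"
proof (induction m)
  case (Suc m)
  then show ?case
    using coeff_norm_add[of "dirichlet_poly m" "smult 2 (cos_poly (Suc m))"]
      coeff_norm_cos_poly[of "Suc m"] zero_le_power[of "19::real" m]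
    unfolding dirichlet_poly.simps coeff_norm_smult power_Suc by linarith
qed (simp add: one_pCons)

text \<open>The sum telescopes: 2 sin t cos(2 j t) is a difference of sines of consecutive odd
  multiples of t. The product form stays valid where sin t = 0.\<close>

lemma sin_mult_dirichlet_poly:
  "sin t * poly (dirichlet_poly m) (sin t) = sin ((2 * real m + 1) * t)"
proof (induction m)
  case (Suc m)
  have "sin ((2 * real (Suc m) + 1) * t) - sin ((2 * real m + 1) * t)
      = 2 * sin t * cos (2 * real (Suc m) * t)"
    by (simp add: sin_diff_sin algebra_simps add_divide_distrib)
  then show ?case
    using Suc by (simp add: poly_cos_poly algebra_simps del: cos_poly.simps)
qed simp

text \<open>Every s in [-1, 1] is a sine, so each cosine in the sum is at most 1 in absolute value.
  This controls the kernel near 0.\<close>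

lemma dirichlet_poly_le:
  assumes "\<bar>s\<bar> \<le> 1"
  shows "\<bar>poly (dirichlet_poly m) s\<bar> \<le> 2 * real m + 1"
proof (induction m)
  case (Suc m)
  have "s = sin (arcsin s)"
    using assms by (simp add: abs_le_iff)
  then have "\<bar>poly (cos_poly (Suc m)) s\<bar> \<le> 1"
    by (metis poly_cos_poly abs_cos_le_one)
  with Suc show ?case
    by (simp del: cos_poly.simps)
qed simp

text \<open>The closed form of the kernel gives its decay 1 / |s| away from 0.\<close>

lemma abs_mult_dirichlet_poly_le:
  assumes "\<bar>s\<bar> \<le> 1"
  shows "\<bar>s * poly (dirichlet_poly m) s\<bar> \<le> 1"
proof -
  have "s = sin (arcsin s)"
    using assms by (simp add: abs_le_iff)
  then show ?thesis
    by (metis sin_mult_dirichlet_poly abs_sin_le_one)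
qed

text \<open>The comparison is with |sin t| instead of |t|, so that later estimates can be phrased in
  s = sin t alone.\<close>

lemma abs_sin_nat_mult_le: "\<bar>sin (real j * t)\<bar> \<le> real j * \<bar>sin t\<bar>" for t :: real
proof (induction j)
  case (Suc j)
  have "real (Suc j) * t = real j * t + t"
    by (simp add: algebra_simps)
  then have "\<bar>sin (real (Suc j) * t)\<bar> = \<bar>sin (real j * t) * cos t + cos (real j * t) * sin t\<bar>"
    by (simp only: sin_add)
  also have "\<dots> \<le> \<bar>sin (real j * t)\<bar> * \<bar>cos t\<bar> + \<bar>cos (real j * t)\<bar> * \<bar>sin t\<bar>"
    by (metis abs_mult abs_triangle_ineq)
  also have "\<dots> \<le> \<bar>sin (real j * t)\<bar> * 1 + 1 * \<bar>sin t\<bar>"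
    by (intro add_mono mult_mono) auto
  finally show ?case
    using Suc by (simp add: algebra_simps)
qed simp

lemma cos_poly_ge:
  assumes "\<bar>s\<bar> \<le> 1"
  shows "poly (cos_poly j) s \<ge> 1 - 2 * (real j * s)\<^sup>2"
proof -
  define t where "t = arcsin s"
  have s: "s = sin t"
    using assms by (simp add: t_def abs_le_iff)
  have "(sin (real j * t))\<^sup>2 \<le> (real j * s)\<^sup>2"
    using abs_sin_nat_mult_le[of j t] by (intro abs_le_square_iff[THEN iffD1]) (simp add: abs_mult s)
  moreover have "poly (cos_poly j) s = 1 - 2 * (sin (real j * t))\<^sup>2"
    using cos_double_sin[of "real j * t"] by (simp add: s poly_cos_poly mult.assoc)
  ultimately show ?thesis by simp
qed

text \<open>In this range |j s| \<le> 1/2 for all j \<le> m, so every cosine is at least 1 - 2/4 =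
  1/2 and the partial sums grow by at least 1 per step.\<close>

lemma dirichlet_poly_ge:
  assumes "\<bar>s\<bar> \<le> 1 / (2 * real m + 1)"
  shows "poly (dirichlet_poly m) s \<ge> (2 * real m + 1) / 2"
proof -
  \<comment> \<open>The range allowed for s depends on m, so the induction runs over k \<le> m with
    s and m fixed.\<close>
  have "poly (dirichlet_poly k) s \<ge> (2 * real k + 1) / 2" if "k \<le> m" for k
    using that
  proof (induction k)
    case (Suc k)
    have "\<bar>s\<bar> * (2 * real m + 1) \<le> 1"
      using assms by (simp add: field_simps)
    moreover have "\<bar>s\<bar> * (2 * real (Suc k)) \<le> \<bar>s\<bar> * (2 * real m + 1)"
      using Suc.prems by (intro mult_left_mono) auto
    moreover have "\<bar>real (Suc k) * s\<bar> = \<bar>s\<bar> * (2 * real (Suc k)) / 2"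
      by (simp add: abs_mult)
    ultimately have "\<bar>real (Suc k) * s\<bar> \<le> \<bar>1 / 2\<bar>"
      by simp
    then have "(real (Suc k) * s)\<^sup>2 \<le> (1 / 2)\<^sup>2"
      by (simp only: abs_le_square_iff)
    moreover have "\<bar>s\<bar> \<le> 1"
      using assms by (rule order_trans) simp
    ultimately have "poly (cos_poly (Suc k)) s \<ge> 1 / 2"
      using cos_poly_ge[of s "Suc k"] by (simp add: power2_eq_square)
    with Suc show ?case
      by (simp del: cos_poly.simps)
  qed simp
  then show ?thesis by simp
qed

section \<open>Translates of planar convex sets\<close>

lemma borel_measurable_poly [measurable]: "(\<lambda>x. poly p x) \<in> borel_measurable borel" for p :: "real poly"
  by (intro borel_measurable_continuous_onI continuous_intros)

lemma measurable_fst_snd_borel [measurable]: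
  "fst \<in> borel_measurable (borel :: (real \<times> real) measure)"
  "snd \<in> borel_measurable (borel :: (real \<times> real) measure)"
  by (intro borel_measurable_continuous_onI continuous_intros)+

lemma nn_integral_lborel_translate:
  fixes c :: "'a::euclidean_space"
  assumes [measurable]: "f \<in> borel_measurable borel"
  shows "(\<integral>\<^sup>+x. f (x - c) \<partial>lborel) = (\<integral>\<^sup>+x. f x \<partial>lborel)"
proof -
  have "(\<integral>\<^sup>+x. f x \<partial>lborel) = (\<integral>\<^sup>+x. f x \<partial>distr lborel borel ((+) (- c)))"
    by (simp add: lborel_distr_plus)
  then show ?thesis
    by (simp add: nn_integral_distr)
qed

lemma distr_lborel_reflect:
  fixes c :: "'a::euclidean_space"
  shows "distr lborel borel (\<lambda>x. c - x) = lborel"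
  using lborel_affine[of "-1" c] by (simp add: density_1)

text \<open>This serves the substitution w = z - v, which turns an integral against p(z - w) into a
  convolution in v.\<close>

lemma integral_lborel_reflect:
  fixes f :: "'a::euclidean_space \<Rightarrow> real"
  assumes [measurable]: "f \<in> borel_measurable borel"
  shows "(\<integral>x. f (c - x) \<partial>lborel) = (\<integral>x. f x \<partial>lborel)"
proof -
  have "(\<integral>x. f x \<partial>lborel) = (\<integral>x. f x \<partial>distr lborel borel (\<lambda>x. c - x))"
    by (simp add: distr_lborel_reflect)
  then show ?thesis
    by (simp add: integral_distr)
qed

lemma nn_integral_prod_fst:
  assumes "f \<in> borel_measurable (borel :: (real \<times> real) measure)"
  shows "(\<integral>\<^sup>+z. f z \<partial>lborel) = (\<integral>\<^sup>+x. \<integral>\<^sup>+y. f (x, y) \<partial>lborel \<partial>lborel)"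
proof -
  have "f \<in> borel_measurable (lborel \<Otimes>\<^sub>M lborel)"
    using assms by (simp add: lborel_prod)
  from lborel.nn_integral_fst[OF this] show ?thesis
    by (simp add: lborel_prod)
qed

lemma nn_integral_prod_snd:
  assumes "f \<in> borel_measurable (borel :: (real \<times> real) measure)"
  shows "(\<integral>\<^sup>+z. f z \<partial>lborel) = (\<integral>\<^sup>+y. \<integral>\<^sup>+x. f (x, y) \<partial>lborel \<partial>lborel)"
proof -
  have "f \<in> borel_measurable (lborel \<Otimes>\<^sub>M lborel)"
    using assms by (simp add: lborel_prod)
  from lborel_pair.nn_integral_snd[OF this] show ?thesis
    by (simp add: lborel_prod)
qed

lemma nn_integral_prod_mult:
  assumes [measurable]: "f \<in> borel_measurable (borel :: real measure)" "g \<in> borel_measurable (borel :: real measure)"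
  shows "(\<integral>\<^sup>+z. f (fst z) * g (snd z) \<partial>lborel) = (\<integral>\<^sup>+x. f x \<partial>lborel) * (\<integral>\<^sup>+y. g y \<partial>lborel)"
  by (subst nn_integral_prod_fst) (auto simp: nn_integral_cmult nn_integral_multc)

section \<open>Translation estimates for indicators\<close>

text \<open>An interval and its translate differ only between each endpoint and its shifted copy,
  which are two gaps of length |s|.\<close>

lemma indicator_translate_interval:
  fixes S :: "real set"
  assumes "compact S" "convex S"
  shows "(\<integral>\<^sup>+x. ennreal \<bar>indicator S x - indicator S (x - s)\<bar> \<partial>lborel) \<le> ennreal (2 * \<bar>s\<bar>)"
proof -
  \<comment> \<open>The empty set is included here as an interval with a > b.\<close>
  obtain a b where S: "S = {a..b}"
    using assms connected_compact_interval_1 convex_connected by blast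
  have "(\<integral>\<^sup>+x. ennreal \<bar>indicator S x - indicator S (x - s)\<bar> \<partial>lborel)
      \<le> (\<integral>\<^sup>+x. indicator {min a (a + s)..max a (a + s)} x
          + indicator {min b (b + s)..max b (b + s)} x \<partial>lborel)"
    unfolding S by (intro nn_integral_mono) (auto simp: indicator_def)
  also have "\<dots> = ennreal \<bar>s\<bar> + ennreal \<bar>s\<bar>"
    by (subst nn_integral_add) (auto simp: max_def min_def abs_if)
  also have "\<dots> = ennreal (2 * \<bar>s\<bar>)"
    by (simp flip: ennreal_plus)
  finally show ?thesis .
qed

text \<open>The slice is a linear image of the intersection of K with a horizontal line, and
  inherits both properties.\<close>

lemma slice_fst:
  fixes K :: "(real \<times> real) set"
  assumes "compact K" "convex K"
  shows "compact {x. (x, y) \<in> K}" "convex {x. (x, y) \<in> K}"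
proof -
  have "{x. (x, y) \<in> K} = fst ` (K \<inter> UNIV \<times> {y})"
    by force
  moreover have "compact (K \<inter> UNIV \<times> {y})"
    using assms by (intro compact_Int_closed closed_Times) auto
  moreover have "convex (K \<inter> UNIV \<times> {y})"
    using assms by (intro convex_Int convex_Times) auto
  ultimately show "compact {x. (x, y) \<in> K}" "convex {x. (x, y) \<in> K}"
    by (auto intro!: compact_continuous_image continuous_intros convex_linear_image linear_fst)
qed

lemma slice_snd:
  fixes K :: "(real \<times> real) set"
  assumes "compact K" "convex K"
  shows "compact {y. (x, y) \<in> K}" "convex {y. (x, y) \<in> K}"
proof -
  have "{y. (x, y) \<in> K} = snd ` (K \<inter> {x} \<times> UNIV)"
    by force
  moreover have "compact (K \<inter> {x} \<times> UNIV)"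
    using assms by (intro compact_Int_closed closed_Times) auto
  moreover have "convex (K \<inter> {x} \<times> UNIV)"
    using assms by (intro convex_Int convex_Times) auto
  ultimately show "compact {y. (x, y) \<in> K}" "convex {y. (x, y) \<in> K}"
    by (auto intro!: compact_continuous_image continuous_intros convex_linear_image linear_snd)
qed

text \<open>The translation is made one coordinate at a time. Each slice is an interval and costs
  twice the shift, and only slices over [0, 1] are nonempty.\<close>

lemma indicator_translate_planar:
  fixes K :: "(real \<times> real) set"
  assumes "compact K" "convex K" and sub: "K \<subseteq> {0..1} \<times> {0..1}"
  shows "(\<integral>\<^sup>+z. ennreal \<bar>indicator K z - indicator K (z - v)\<bar> \<partial>lborel)
    \<le> ennreal (2 * (\<bar>fst v\<bar> + \<bar>snd v\<bar>))"
proof -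
  have [measurable]: "K \<in> sets borel"
    using assms by (intro borel_closed compact_imp_closed)
  define s t where "s = fst v" and "t = snd v"
  have one: "(\<integral>\<^sup>+x. ennreal \<bar>indicator K (x, y) - indicator K (x - s, y)\<bar> \<partial>lborel)
      \<le> ennreal (2 * \<bar>s\<bar>) * indicator {0..1} y" for y
  proof (cases "y \<in> {0..1}")
    case True
    then show ?thesis
      using indicator_translate_interval[OF slice_fst[OF assms(1,2)], of y s]
      by (simp add: indicator_def)
  next
    case False
    then have "indicator K (x, y) = (0::real)" for x
      using sub by (auto simp: indicator_def)
    then show ?thesis by simp
  qed
  have two: "(\<integral>\<^sup>+y. ennreal \<bar>indicator K (x, y) - indicator K (x, y - t)\<bar> \<partial>lborel)
      \<le> ennreal (2 * \<bar>t\<bar>) * indicator {0..1} x" for x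
  proof (cases "x \<in> {0..1}")
    case True
    then show ?thesis
      using indicator_translate_interval[OF slice_snd[OF assms(1,2)], of x t]
      by (simp add: indicator_def)
  next
    case False
    then have "indicator K (x, y) = (0::real)" for y
      using sub by (auto simp: indicator_def)
    then show ?thesis by simp
  qed
  \<comment> \<open>Triangle inequality through the intermediate translate by (s, 0).\<close>
  have "(\<integral>\<^sup>+z. ennreal \<bar>indicator K z - indicator K (z - v)\<bar> \<partial>lborel)
      \<le> (\<integral>\<^sup>+z. ennreal \<bar>indicator K z - indicator K (z - (s, 0))\<bar>
          + ennreal \<bar>indicator K (z - (s, 0)) - indicator K (z - (s, 0) - (0, t))\<bar> \<partial>lborel)"
  proof (intro nn_integral_mono)
    fix z :: "real \<times> real"
    have eq: "z - (s, 0) - (0, t) = z - v"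
      by (simp add: prod_eq_iff s_def t_def)
    show "ennreal \<bar>indicator K z - indicator K (z - v)\<bar>
        \<le> ennreal \<bar>indicator K z - indicator K (z - (s, 0))\<bar>
          + ennreal \<bar>indicator K (z - (s, 0)) - indicator K (z - (s, 0) - (0, t))\<bar>"
      unfolding eq ennreal_plus[symmetric, OF abs_ge_zero abs_ge_zero]
      by (intro ennreal_leI) linarith
  qed
  also have "\<dots> = (\<integral>\<^sup>+z. ennreal \<bar>indicator K z - indicator K (z - (s, 0))\<bar> \<partial>lborel)
      + (\<integral>\<^sup>+z. ennreal \<bar>indicator K (z - (s, 0)) - indicator K (z - (s, 0) - (0, t))\<bar> \<partial>lborel)"
    by (intro nn_integral_add) measurable
  \<comment> \<open>Translation invariance removes the common shift by (s, 0).\<close>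
  also have "(\<integral>\<^sup>+z. ennreal \<bar>indicator K (z - (s, 0)) - indicator K (z - (s, 0) - (0, t))\<bar> \<partial>lborel)
      = (\<integral>\<^sup>+z. ennreal \<bar>indicator K z - indicator K (z - (0, t))\<bar> \<partial>lborel)"
    by (rule nn_integral_lborel_translate[where f = "\<lambda>z. ennreal \<bar>indicator K z - indicator K (z - (0, t))\<bar>"]) measurable
  also have "\<dots> = (\<integral>\<^sup>+x. \<integral>\<^sup>+y. ennreal \<bar>indicator K (x, y) - indicator K (x, y - t)\<bar> \<partial>lborel \<partial>lborel)"
    by (subst nn_integral_prod_fst) auto
  also have "\<dots> \<le> (\<integral>\<^sup>+x. ennreal (2 * \<bar>t\<bar>) * indicator {0..1::real} x \<partial>lborel)"
    by (intro nn_integral_mono two)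
  also have "\<dots> = ennreal (2 * \<bar>t\<bar>)"
    by (subst nn_integral_cmult_indicator) auto
  also have "(\<integral>\<^sup>+z. ennreal \<bar>indicator K z - indicator K (z - (s, 0))\<bar> \<partial>lborel)
      = (\<integral>\<^sup>+y. \<integral>\<^sup>+x. ennreal \<bar>indicator K (x, y) - indicator K (x - s, y)\<bar> \<partial>lborel \<partial>lborel)"
    by (subst nn_integral_prod_snd) auto
  also have "\<dots> \<le> (\<integral>\<^sup>+y. ennreal (2 * \<bar>s\<bar>) * indicator {0..1::real} y \<partial>lborel)"
    by (intro nn_integral_mono one)
  also have "\<dots> = ennreal (2 * \<bar>s\<bar>)"
    by (subst nn_integral_cmult_indicator) auto
  finally show ?thesis
    by (simp add: s_def t_def add_right_mono algebra_simps flip: ennreal_plus)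
qed

section \<open>The moment form and the first absolute moment of the kernel\<close>

text \<open>Expanding both factors p separates z from w, so the double integral becomes a sum of
  products of two moments. Each moment is at most \<epsilon> in absolute value, and the coefficients
  have absolute sum \<open>coeff_norm p\<close> per factor.\<close>

lemma moment_form_le:
  fixes g :: "real \<times> real \<Rightarrow> real"
  defines "m \<equiv> \<lambda>i j. \<integral>w. fst w ^ i * snd w ^ j * g w \<partial>lborel"
  assumes int: "\<And>i j. integrable lborel (\<lambda>w. fst w ^ i * snd w ^ j * g w)"
    and bound: "\<And>i j. i \<le> n \<Longrightarrow> j \<le> n \<Longrightarrow> \<bar>m i j\<bar> \<le> \<epsilon>"
    and deg: "degree p \<le> n"
  shows "\<bar>\<integral>z. (\<integral>w. poly p (fst z - fst w) * poly p (snd z - snd w) * g w \<partial>lborel) * g z \<partial>lborel\<bar>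
    \<le> (coeff_norm p)\<^sup>2 * \<epsilon>\<^sup>2"
proof -
  define T where "T = {(i, j). i + j \<le> n}"
  define c where "c = diff_coeff p"
  have T: "i \<le> n \<and> j \<le> n" if "(i, j) \<in> T" for i j
    using that by (auto simp: T_def)
  have p: "poly p (x - y) = (\<Sum>a\<in>T. c a * x ^ fst a * y ^ snd a)" for x y
    using poly_diff_expansion[OF deg, of x y] by (simp add: T_def c_def case_prod_unfold)
  \<comment> \<open>The index a expands the first coordinate and b the second; the
    \<open>fst\<close> exponents belong to z and the \<open>snd\<close> exponents to w.\<close>
  have inner: "(\<integral>w. poly p (fst z - fst w) * poly p (snd z - snd w) * g w \<partial>lborel)
      = (\<Sum>a\<in>T. \<Sum>b\<in>T. c a * c b * m (snd a) (snd b) * (fst z ^ fst a * snd z ^ fst b))" for z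
  proof -
    have "(\<integral>w. poly p (fst z - fst w) * poly p (snd z - snd w) * g w \<partial>lborel)
        = (\<integral>w. (\<Sum>a\<in>T. \<Sum>b\<in>T. (c a * c b * fst z ^ fst a * snd z ^ fst b)
            * (fst w ^ snd a * snd w ^ snd b * g w)) \<partial>lborel)"
      unfolding p sum_product
      unfolding sum_distrib_right by (simp add: mult_ac)
    also have "\<dots> = (\<Sum>a\<in>T. \<Sum>b\<in>T. (c a * c b * fst z ^ fst a * snd z ^ fst b) * m (snd a) (snd b))"
      using int by (simp add: m_def)
    finally show ?thesis by (simp add: mult_ac)
  qed
  have "(\<integral>z. (\<integral>w. poly p (fst z - fst w) * poly p (snd z - snd w) * g w \<partial>lborel) * g z \<partial>lborel)
      = (\<integral>z. (\<Sum>a\<in>T. \<Sum>b\<in>T. (c a * c b * m (snd a) (snd b)) * (fst z ^ fst a * snd z ^ fst b * g z)) \<partial>lborel)"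
    unfolding inner sum_distrib_right by (simp add: mult_ac)
  also have "\<dots> = (\<Sum>a\<in>T. \<Sum>b\<in>T. (c a * c b * m (snd a) (snd b)) * m (fst a) (fst b))"
    using int by (simp add: m_def)
  also have "\<bar>\<dots>\<bar> \<le> (\<Sum>a\<in>T. \<Sum>b\<in>T. \<bar>c a\<bar> * \<bar>c b\<bar> * (\<epsilon> * \<epsilon>))"
  proof (intro order_trans[OF sum_abs] sum_mono)
    fix a b assume "a \<in> T" "b \<in> T"
    then have "\<bar>m (snd a) (snd b)\<bar> * \<bar>m (fst a) (fst b)\<bar> \<le> \<epsilon> * \<epsilon>"
      \<comment> \<open>The last fact supplies \<epsilon> \<ge> 0, which holds because \<epsilon>
        bounds an absolute value.\<close>
      using T[of "fst a" "snd a"] T[of "fst b" "snd b"] bound order_trans[OF abs_ge_zero bound]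
      by (intro mult_mono) auto
    then show "\<bar>c a * c b * m (snd a) (snd b) * m (fst a) (fst b)\<bar> \<le> \<bar>c a\<bar> * \<bar>c b\<bar> * (\<epsilon> * \<epsilon>)"
      by (simp add: abs_mult mult.assoc mult_left_mono)
  qed
  also have "\<dots> = (\<Sum>a\<in>T. \<bar>c a\<bar>) * (\<Sum>b\<in>T. \<bar>c b\<bar>) * (\<epsilon> * \<epsilon>)"
    unfolding sum_product
    unfolding sum_distrib_right ..
  also have "\<dots> = (coeff_norm p)\<^sup>2 * \<epsilon>\<^sup>2"
    using sum_abs_diff_coeff[OF deg] by (simp add: T_def c_def power2_eq_square)
  finally show ?thesis .
qed

section \<open>Mass and first absolute moment of the fourth power of the Dirichlet kernel\<close>

text \<open>The central peak suffices: on |s| \<le> 1/M the kernel is at least (M/2)^4, and this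
  interval has length 2/M.\<close>

lemma dirichlet_kernel_mass:
  fixes m :: nat
  defines "M \<equiv> 2 * real m + 1"
  shows "ennreal (M ^ 3 / 8) \<le> (\<integral>\<^sup>+s. ennreal (poly (dirichlet_poly m ^ 4) s) * indicator {-1..1} s \<partial>lborel)"
proof -
  have M: "M \<ge> 1" by (simp add: M_def)
  have "ennreal (M ^ 3 / 8) = ennreal ((M / 2) ^ 4) * ennreal (2 / M)"
    using M by (simp add: field_simps eval_nat_numeral flip: ennreal_mult)
  also have "\<dots> = (\<integral>\<^sup>+s. ennreal ((M / 2) ^ 4) * indicator {- (1 / M)..1 / M} s \<partial>lborel)"
    using M by (subst nn_integral_cmult_indicator) auto
  also have "\<dots> \<le> (\<integral>\<^sup>+s. ennreal (poly (dirichlet_poly m ^ 4) s) * indicator {-1..1} s \<partial>lborel)"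
  proof (intro nn_integral_mono)
    fix s :: real
    show "ennreal ((M / 2) ^ 4) * indicator {- (1 / M)..1 / M} s
        \<le> ennreal (poly (dirichlet_poly m ^ 4) s) * indicator {-1..1} s"
    proof (cases "\<bar>s\<bar> \<le> 1 / M")
      case True
      moreover have "1 / M \<le> 1"
        using M by simp
      ultimately have "\<bar>s\<bar> \<le> 1" by linarith
      moreover have "(M / 2) ^ 4 \<le> poly (dirichlet_poly m) s ^ 4"
        using True dirichlet_poly_ge[of s m] M by (intro power_mono) (auto simp: M_def)
      ultimately show ?thesis
        using True by (auto simp: indicator_def abs_le_iff poly_power intro!: ennreal_leI)
    next
      case False
      then have "s \<notin> {- (1 / M)..1 / M}"
        by auto
      then show ?thesis by simp
    qed
  qed
  finally show ?thesis .
qed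

text \<open>With q the Dirichlet polynomial, in |s| q^4 one factor q^2 absorbs |s| and the other
  supplies quadratic decay, so the integral is of order M^2. With q^2 in place of q^4 the decay
  bound would be only 1/|s|, at the cost of a logarithm.\<close>

lemma dirichlet_kernel_first_moment:
  fixes m :: nat
  defines "M \<equiv> 2 * real m + 1"
  shows "(\<integral>\<^sup>+s. ennreal (\<bar>s\<bar> * poly (dirichlet_poly m ^ 4) s) * indicator {-1..1} s \<partial>lborel) \<le> ennreal (8 * M\<^sup>2)"
proof -
  have M: "M \<ge> 1" by (simp add: M_def)
  define f where "f s = 2 * M ^ 3 / (1 + (M * s)\<^sup>2)" for s :: real
  have pos: "1 + (M * s)\<^sup>2 > 0" for s
    by (simp add: add_pos_nonneg)
  have [measurable]: "f \<in> borel_measurable borel"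
    unfolding f_def by measurable
  have le: "\<bar>s\<bar> * poly (dirichlet_poly m ^ 4) s \<le> f s" if "\<bar>s\<bar> \<le> 1" for s
  proof -
    define q where "q = poly (dirichlet_poly m) s"
    have "q\<^sup>2 \<le> M\<^sup>2"
      using dirichlet_poly_le[OF that, of m] M by (simp add: abs_le_square_iff[symmetric] q_def M_def)
    moreover have "(s * q)\<^sup>2 \<le> 1"
      using abs_mult_dirichlet_poly_le[OF that, of m] by (simp add: abs_square_le_1 q_def)
    then have "(M * s)\<^sup>2 * q\<^sup>2 \<le> M\<^sup>2"
      using mult_left_mono[of "(s * q)\<^sup>2" 1 "M\<^sup>2"] by (simp add: power_mult_distrib mult_ac)
    \<comment> \<open>The bounds near 0 and away from 0 are added into a single one.\<close>
    ultimately have *: "q\<^sup>2 * (1 + (M * s)\<^sup>2) \<le> 2 * M\<^sup>2"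
      by (simp add: algebra_simps)
    \<comment> \<open>AM-GM trades \<open>\<bar>s\<bar>\<close> for a factor that leaves a majorant with the smooth antiderivative \<open>arctan\<close>.\<close>
    have "2 * (M * \<bar>s\<bar>) \<le> 1 + (M * s)\<^sup>2"
      using zero_le_power2[of "1 - M * \<bar>s\<bar>"] by (simp add: power2_diff power_mult_distrib)
    then have "2 * M * \<bar>s\<bar> * q\<^sup>2 \<le> 2 * M\<^sup>2"
      using * mult_right_mono[of "2 * (M * \<bar>s\<bar>)" "1 + (M * s)\<^sup>2" "q\<^sup>2"] by (simp add: mult_ac)
    then have "\<bar>s\<bar> * q\<^sup>2 \<le> M"
      using M by (simp add: power2_eq_square)
    then have "\<bar>s\<bar> * q\<^sup>2 * (q\<^sup>2 * (1 + (M * s)\<^sup>2)) \<le> M * (2 * M\<^sup>2)"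
      using M by (intro mult_mono[OF _ *]) auto
    then have "\<bar>s\<bar> * q ^ 4 * (1 + (M * s)\<^sup>2) \<le> 2 * M ^ 3"
      by (simp add: eval_nat_numeral mult_ac)
    then show ?thesis
      using pos[of s] by (simp add: f_def q_def pos_le_divide_eq)
  qed
  have "(\<integral>\<^sup>+s. ennreal (\<bar>s\<bar> * poly (dirichlet_poly m ^ 4) s) * indicator {-1..1} s \<partial>lborel)
      \<le> (\<integral>\<^sup>+s. ennreal (f s) * indicator {-1..1} s \<partial>lborel)"
    using le by (intro nn_integral_mono) (auto simp: indicator_def intro!: ennreal_leI simp del: poly_power)
  also have "\<dots> = ennreal (2 * M\<^sup>2 * arctan (M * 1) - 2 * M\<^sup>2 * arctan (M * (-1)))"
  proof (rule nn_integral_FTC_Icc)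
    fix s :: real
    show "((\<lambda>s. 2 * M\<^sup>2 * arctan (M * s)) has_real_derivative f s) (at s)"
      using pos[of s] by (auto intro!: derivative_eq_intros simp: f_def field_simps eval_nat_numeral)
    show "0 \<le> f s"
      using M pos[of s] by (simp add: f_def)
  qed auto
  also have "\<dots> \<le> ennreal (8 * M\<^sup>2)"
  proof (intro ennreal_leI)
    \<comment> \<open>The numerical bound arctan M < pi/2 < 2 is all that is used.\<close>
    have "2 * M\<^sup>2 * arctan M \<le> 2 * M\<^sup>2 * 2"
      using arctan_ubound[of M] pi_less_4 by (intro mult_left_mono) auto
    then show "2 * M\<^sup>2 * arctan (M * 1) - 2 * M\<^sup>2 * arctan (M * (-1)) \<le> 8 * M\<^sup>2"
      by (simp add: arctan_minus)
  qed
  finally show ?thesis .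
qed

text \<open>The kernel is divided by its mass I. First moment over mass is at most 8 M^2 / (M^3 / 8)
  = 64 / M, which is of order 1 / n.\<close>

lemma polynomial_kernel:
  obtains p :: "real poly" where "degree p \<le> n" "\<And>s. poly p s \<ge> 0"
    "(\<integral>\<^sup>+s. ennreal (poly p s) * indicator {-1..1} s \<partial>lborel) = 1"
    "(\<integral>\<^sup>+s. ennreal (\<bar>s\<bar> * poly p s) * indicator {-1..1} s \<partial>lborel) \<le> ennreal (512 / (real n + 1))"
    "(coeff_norm p)\<^sup>2 \<le> 419904 * 19 ^ n"
proof -
  \<comment> \<open>The fourth power of a polynomial of degree at most 2 m has degree at most 8 m,
    hence at most n.\<close>
  define m where "m = n div 8"
  define M where "M = 2 * real m + 1"
  define k where "k = dirichlet_poly m ^ 4"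
  define I where "I = (\<integral>s. indicator {-1..1} s * poly k s \<partial>lborel)"
  have M: "M \<ge> 1" by (simp add: M_def)
  have nonneg: "poly k s \<ge> 0" for s
    by (simp add: k_def)
  have "integrable lborel (\<lambda>s. indicator {-1..1} s *\<^sub>R poly k s)"
    by (intro borel_integrable_compact continuous_intros) auto
  then have "(\<integral>\<^sup>+s. ennreal (indicator {-1..1} s * poly k s) \<partial>lborel) = ennreal I"
    unfolding I_def using nonneg by (intro nn_integral_eq_integral) auto
  moreover have "ennreal (indicator {-1..1} s * poly k s) = ennreal (poly k s) * indicator {-1..1} s" for s
    by (simp add: indicator_def)
  ultimately have I: "(\<integral>\<^sup>+s. ennreal (poly k s) * indicator {-1..1} s \<partial>lborel) = ennreal I"
    by simp
  have "I \<ge> 0"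
    unfolding I_def using nonneg by (intro Bochner_Integration.integral_nonneg) auto
  then have I_ge: "M ^ 3 / 8 \<le> I"
    using dirichlet_kernel_mass[of m] I by (simp add: k_def M_def del: poly_power)
  moreover have "M ^ 3 \<ge> 1"
    using M by simp
  \<comment> \<open>This crude bound makes 1 / I positive and at most 8, for the coefficient norm;
    the first moment uses the sharper \<open>I_ge\<close>.\<close>
  ultimately have I8: "I \<ge> 1 / 8" by linarith
  define p where "p = smult (1 / I) k"
  have poly_p: "poly p s = 1 / I * poly k s" for s
    by (simp add: p_def)
  show ?thesis
  proof
    have "degree k \<le> 2 * m * 4"
      unfolding k_def using degree_power_le[of "dirichlet_poly m" 4] degree_dirichlet_poly[of m] by simp
    then show "degree p \<le> n"
      unfolding p_def m_def using I8 by simp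
    show "poly p s \<ge> 0" for s
      using nonneg I8 by (simp add: poly_p)
    have "(\<integral>\<^sup>+s. ennreal (poly p s) * indicator {-1..1} s \<partial>lborel)
        = (\<integral>\<^sup>+s. ennreal (1 / I) * (ennreal (poly k s) * indicator {-1..1} s) \<partial>lborel)"
      using I8 nonneg by (intro nn_integral_cong) (simp add: poly_p indicator_def flip: ennreal_mult)
    also have "\<dots> = ennreal (1 / I) * (\<integral>\<^sup>+s. ennreal (poly k s) * indicator {-1..1} s \<partial>lborel)"
      by (intro nn_integral_cmult) auto
    finally show "(\<integral>\<^sup>+s. ennreal (poly p s) * indicator {-1..1} s \<partial>lborel) = 1"
      using I8 by (simp add: I flip: ennreal_mult)
    have "(\<integral>\<^sup>+s. ennreal (\<bar>s\<bar> * poly p s) * indicator {-1..1} s \<partial>lborel)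
        = (\<integral>\<^sup>+s. ennreal (1 / I) * (ennreal (\<bar>s\<bar> * poly k s) * indicator {-1..1} s) \<partial>lborel)"
      using I8 nonneg
      by (intro nn_integral_cong) (simp add: poly_p indicator_def flip: ennreal_mult)
    also have "\<dots> = ennreal (1 / I) * (\<integral>\<^sup>+s. ennreal (\<bar>s\<bar> * poly k s) * indicator {-1..1} s \<partial>lborel)"
      by (intro nn_integral_cmult) auto
    also have "\<dots> \<le> ennreal (1 / I) * ennreal (8 * M\<^sup>2)"
      using dirichlet_kernel_first_moment[of m] by (intro mult_left_mono) (auto simp: k_def M_def)
    also have "\<dots> = ennreal (8 * M\<^sup>2 / I)"
      using I8 by (simp flip: ennreal_mult)
    also have "\<dots> \<le> ennreal (512 / (real n + 1))"
    proof (intro ennreal_leI)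
      have "8 * M\<^sup>2 / I \<le> 8 * M\<^sup>2 / (M ^ 3 / 8)"
        using I_ge M by (intro divide_left_mono) (auto intro!: mult_pos_pos I8[THEN less_le_trans[rotated]])
      also have "\<dots> = 64 / M"
        using M by (simp add: field_simps eval_nat_numeral)
      also have "\<dots> \<le> 512 / (real n + 1)"
      proof -
        \<comment> \<open>Since n \<le> 8 m + 7, n + 1 is at most 8 m + 8, hence at most 8
          M.\<close>
        have "n + 1 \<le> 8 * (2 * m + 1)"
          unfolding m_def by presburger
        then have "real (n + 1) \<le> real (8 * (2 * m + 1))"
          by (simp only: of_nat_le_iff)
        then show ?thesis
          using M by (simp add: M_def divide_simps)
      qed
      finally show "8 * M\<^sup>2 / I \<le> 512 / (real n + 1)" .
    qed
    finally show "(\<integral>\<^sup>+s. ennreal (\<bar>s\<bar> * poly p s) * indicator {-1..1} s \<partial>lborel) \<le> ennreal (512 / (real n + 1))" .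
    have "coeff_norm k \<le> (3 * 19 ^ m) ^ 4"
      unfolding k_def using coeff_norm_power[of "dirichlet_poly m" 4]
        power_mono[OF coeff_norm_dirichlet_poly[of m] coeff_norm_nonneg, of 4] by linarith
    then have "coeff_norm p \<le> 8 * (3 * 19 ^ m) ^ 4"
      unfolding p_def coeff_norm_smult using I8
      by (intro mult_mono) (auto simp: divide_simps)
    then have "(coeff_norm p)\<^sup>2 \<le> (8 * (3 * 19 ^ m) ^ 4)\<^sup>2"
      by (intro power_mono) auto
    \<comment> \<open>The constant is 8^2 * 3^8.\<close>
    also have "\<dots> = 419904 * 19 ^ (8 * m)"
      by (simp add: power_mult_distrib flip: power_mult)
    also have "\<dots> \<le> 419904 * 19 ^ n"
      unfolding m_def by (intro mult_left_mono power_increasing) auto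
    finally show "(coeff_norm p)\<^sup>2 \<le> 419904 * 19 ^ n" .
  qed
qed

section \<open>Nikodym distance and moments\<close>

lemma nikodym_dist_le:
  fixes K L :: "(real \<times> real) set" and p :: "real poly"
  assumes K: "compact K" "convex K" "K \<subseteq> {0..1} \<times> {0..1}"
    and L: "compact L" "convex L" "L \<subseteq> {0..1} \<times> {0..1}"
    and p_nonneg: "\<And>s. poly p s \<ge> 0"
    and mass: "(\<integral>\<^sup>+s. ennreal (poly p s) * indicator {-1..1} s \<partial>lborel) = 1"
    and first_moment: "(\<integral>\<^sup>+s. ennreal (\<bar>s\<bar> * poly p s) * indicator {-1..1} s \<partial>lborel) \<le> ennreal \<eta>"
    and eta: "\<eta> \<ge> 0"
  defines "g \<equiv> \<lambda>z. indicator K z - indicator L z :: real"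
  shows "nikodym_dist K L
    \<le> (\<integral>z. (\<integral>w. poly p (fst z - fst w) * poly p (snd z - snd w) * g w \<partial>lborel) * g z \<partial>lborel) + 8 * \<eta>"
proof -
  \<comment> \<open>Differences of points of the unit square lie in Q. Truncating the kernel to Q
    therefore changes nothing on the support of g, and it makes W a probability density.\<close>
  define Q :: "(real \<times> real) set" where "Q = {-1..1} \<times> {-1..1}"
  define W where "W v = indicator Q v * (poly p (fst v) * poly p (snd v))" for v :: "real \<times> real"
  define h where "h z = (\<integral>w. poly p (fst z - fst w) * poly p (snd z - snd w) * g w \<partial>lborel)" for z
  have [measurable]: "K \<in> sets borel" "L \<in> sets borel" "Q \<in> sets borel"
    using K L by (auto simp: Q_def compact_imp_closed closed_Times intro!: borel_closed)
  have [measurable]: "g \<in> borel_measurable borel" "W \<in> borel_measurable borel"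
    unfolding g_def W_def by measurable
  have W_nonneg: "W v \<ge> 0" for v
    by (simp add: W_def p_nonneg)
  have W_split: "ennreal (W v) = (ennreal (poly p (fst v)) * indicator {-1..1} (fst v))
      * (ennreal (poly p (snd v)) * indicator {-1..1} (snd v))" for v
    using p_nonneg by (auto simp: W_def Q_def indicator_def mem_Times_iff ennreal_mult)
  have W_mass: "(\<integral>\<^sup>+v. ennreal (W v) \<partial>lborel) = 1"
    unfolding W_split by (subst nn_integral_prod_mult) (auto simp: mass)
  have W_int: "integrable lborel W"
    using W_mass W_nonneg by (intro integrableI_nonneg) auto
  have "(\<integral>v. W v \<partial>lborel) = 1"
    using W_mass W_nonneg by (simp add: integral_eq_nn_integral)
  \<comment> \<open>The weight |v1| + |v2| splits into two terms, each factoring into a first moment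
    and a mass.\<close>
  have W_moment: "(\<integral>\<^sup>+v. ennreal (W v) * ennreal (\<bar>fst v\<bar> + \<bar>snd v\<bar>) \<partial>lborel) \<le> ennreal (2 * \<eta>)"
  proof -
    define A where "A s = ennreal (poly p s) * indicator {-1..1} s" for s
    define B where "B s = ennreal (\<bar>s\<bar> * poly p s) * indicator {-1..1} s" for s
    have [measurable]: "A \<in> borel_measurable borel" "B \<in> borel_measurable borel"
      unfolding A_def B_def by measurable
    have "(\<integral>\<^sup>+v. ennreal (W v) * ennreal (\<bar>fst v\<bar> + \<bar>snd v\<bar>) \<partial>lborel)
        = (\<integral>\<^sup>+v. B (fst v) * A (snd v) + A (fst v) * B (snd v) \<partial>lborel)"
      unfolding W_split A_def B_def using p_nonneg
      by (intro nn_integral_cong) (auto simp: indicator_def ennreal_mult ennreal_plus algebra_simps)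
    also have "\<dots> = (\<integral>\<^sup>+v. B (fst v) * A (snd v) \<partial>lborel) + (\<integral>\<^sup>+v. A (fst v) * B (snd v) \<partial>lborel)"
      by (intro nn_integral_add) measurable
    also have "\<dots> = (\<integral>\<^sup>+s. B s \<partial>lborel) + (\<integral>\<^sup>+s. B s \<partial>lborel)"
      using mass by (simp add: nn_integral_prod_mult flip: A_def)
    also have "\<dots> \<le> ennreal \<eta> + ennreal \<eta>"
      unfolding B_def by (intro add_mono first_moment)
    finally show ?thesis
      using eta by (simp flip: ennreal_plus)
  qed
  have g_le: "\<bar>g z\<bar> \<le> 1" for z
    by (simp add: g_def indicator_def)
  have g_supp: "g z = 0" if "z \<notin> {0..1} \<times> {0..1}" for z
    using that K L by (auto simp: g_def indicator_def)
  have Wg_int: "integrable lborel (\<lambda>v. W v * g (z - v))" for z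
    by (rule Bochner_Integration.integrable_bound[OF W_int])
       (auto simp: abs_mult intro!: mult_left_le g_le)
  \<comment> \<open>The convolution formula is claimed only on the unit square; elsewhere the factor
    g z vanishes.\<close>
  have h: "h z = (\<integral>v. W v * g (z - v) \<partial>lborel)" if "z \<in> {0..1} \<times> {0..1}" for z
  proof -
    have "h z = (\<integral>v. poly p (fst z - fst (z - v)) * poly p (snd z - snd (z - v)) * g (z - v) \<partial>lborel)"
      unfolding h_def
      by (subst integral_lborel_reflect[where c = z and f = "\<lambda>w. poly p (fst z - fst w) * poly p (snd z - snd w) * g w"]) auto
    also have "\<dots> = (\<integral>v. W v * g (z - v) \<partial>lborel)"
    proof (intro Bochner_Integration.integral_cong refl)
      fix v
      show "poly p (fst z - fst (z - v)) * poly p (snd z - snd (z - v)) * g (z - v) = W v * g (z - v)"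
      proof (cases "z - v \<in> {0..1} \<times> {0..1}")
        case True
        then have "v \<in> Q"
          using that by (auto simp: Q_def mem_Times_iff)
        then show ?thesis by (simp add: W_def)
      qed (simp add: g_supp)
    qed
    finally show ?thesis .
  qed
  \<comment> \<open>As W has mass 1, g z - h z is the W-average of g z - g (z - v); the extra factor
    g z is at most 1 in absolute value.\<close>
  have diff: "ennreal \<bar>g z * g z - h z * g z\<bar> \<le> (\<integral>\<^sup>+v. ennreal (W v) * ennreal \<bar>g z - g (z - v)\<bar> \<partial>lborel)" for z
  proof (cases "z \<in> {0..1} \<times> {0..1}")
    case True
    have "g z - h z = (\<integral>v. W v * g z - W v * g (z - v) \<partial>lborel)"
      using W_int Wg_int \<open>(\<integral>v. W v \<partial>lborel) = 1\<close> by (simp add: h[OF True])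
    then have "ennreal \<bar>g z - h z\<bar> \<le> (\<integral>\<^sup>+v. ennreal (norm (W v * g z - W v * g (z - v))) \<partial>lborel)"
      using integral_norm_bound_ennreal[of lborel "\<lambda>v. W v * g z - W v * g (z - v)"] W_int Wg_int
      by simp
    also have "\<dots> = (\<integral>\<^sup>+v. ennreal (W v) * ennreal \<bar>g z - g (z - v)\<bar> \<partial>lborel)"
      using W_nonneg by (intro nn_integral_cong) (simp add: abs_mult flip: right_diff_distrib ennreal_mult)
    finally have *: "ennreal \<bar>g z - h z\<bar> \<le> (\<integral>\<^sup>+v. ennreal (W v) * ennreal \<bar>g z - g (z - v)\<bar> \<partial>lborel)" .
    have "\<bar>g z * g z - h z * g z\<bar> \<le> \<bar>g z - h z\<bar>"
      using g_le by (simp add: abs_mult mult_left_le flip: left_diff_distrib)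
    then show ?thesis
      using * ennreal_leI order_trans by blast
  qed (simp add: g_supp)
  have gg_int: "integrable lborel (\<lambda>z. g z * g z)"
  proof -
    have "integrable lborel (indicator K :: _ \<Rightarrow> real)" "integrable lborel (indicator L :: _ \<Rightarrow> real)"
      using K L by (auto intro!: integrable_real_indicator emeasure_bounded_finite compact_imp_bounded)
    then have "integrable lborel g"
      unfolding g_def by simp
    moreover have "g z * g z = \<bar>g z\<bar>" for z
      by (simp add: g_def indicator_def)
    ultimately show ?thesis
      by simp
  qed
  have total: "(\<integral>\<^sup>+z. ennreal \<bar>g z * g z - h z * g z\<bar> \<partial>lborel) \<le> ennreal (8 * \<eta>)"
  proof -
    have "(\<integral>\<^sup>+z. ennreal \<bar>g z * g z - h z * g z\<bar> \<partial>lborel)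
        \<le> (\<integral>\<^sup>+z. \<integral>\<^sup>+v. ennreal (W v) * ennreal \<bar>g z - g (z - v)\<bar> \<partial>lborel \<partial>lborel)"
      by (intro nn_integral_mono diff)
    \<comment> \<open>After the interchange v is fixed, and the translation estimate applies to K
      and L separately, giving the factor 2 + 2 = 4.\<close>
    also have "\<dots> = (\<integral>\<^sup>+v. \<integral>\<^sup>+z. ennreal (W v) * ennreal \<bar>g z - g (z - v)\<bar> \<partial>lborel \<partial>lborel)"
      by (rule lborel_pair.Fubini') measurable
    also have "\<dots> \<le> (\<integral>\<^sup>+v. ennreal (W v) * (ennreal 4 * ennreal (\<bar>fst v\<bar> + \<bar>snd v\<bar>)) \<partial>lborel)"
    proof (intro nn_integral_mono)
      fix v :: "real \<times> real"
      have "(\<integral>\<^sup>+z. ennreal \<bar>g z - g (z - v)\<bar> \<partial>lborel)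
          \<le> (\<integral>\<^sup>+z. ennreal \<bar>indicator K z - indicator K (z - v)\<bar>
              + ennreal \<bar>indicator L z - indicator L (z - v)\<bar> \<partial>lborel)"
        by (intro nn_integral_mono) (auto simp: g_def simp flip: ennreal_plus intro!: ennreal_leI)
      also have "\<dots> = (\<integral>\<^sup>+z. ennreal \<bar>indicator K z - indicator K (z - v)\<bar> \<partial>lborel)
          + (\<integral>\<^sup>+z. ennreal \<bar>indicator L z - indicator L (z - v)\<bar> \<partial>lborel)"
        by (intro nn_integral_add) measurable
      also have "\<dots> \<le> ennreal (2 * (\<bar>fst v\<bar> + \<bar>snd v\<bar>)) + ennreal (2 * (\<bar>fst v\<bar> + \<bar>snd v\<bar>))"
        by (intro add_mono indicator_translate_planar K L)
      also have "\<dots> = ennreal 4 * ennreal (\<bar>fst v\<bar> + \<bar>snd v\<bar>)"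
        by (subst ennreal_mult[symmetric]) (simp_all flip: ennreal_plus)
      finally show "(\<integral>\<^sup>+z. ennreal (W v) * ennreal \<bar>g z - g (z - v)\<bar> \<partial>lborel)
          \<le> ennreal (W v) * (ennreal 4 * ennreal (\<bar>fst v\<bar> + \<bar>snd v\<bar>))"
        by (subst nn_integral_cmult) (auto intro: mult_left_mono)
    qed
    also have "\<dots> = ennreal 4 * (\<integral>\<^sup>+v. ennreal (W v) * ennreal (\<bar>fst v\<bar> + \<bar>snd v\<bar>) \<partial>lborel)"
      by (subst nn_integral_cmult[symmetric]) (auto simp: mult_ac)
    also have "\<dots> \<le> ennreal 4 * ennreal (2 * \<eta>)"
      by (intro mult_left_mono W_moment) auto
    also have "\<dots> = ennreal (8 * \<eta>)"
      using eta by (subst ennreal_mult[symmetric]) simp_all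
    finally show ?thesis .
  qed
  have [measurable]: "h \<in> borel_measurable borel"
    unfolding h_def by measurable
  \<comment> \<open>Integrability of h g is obtained backwards: the error g^2 - h g has finite
    absolute integral by \<open>total\<close>, and g^2 is integrable.\<close>
  have diff_int: "integrable lborel (\<lambda>z. g z * g z - h z * g z)"
    using total by (intro integrableI_bounded) (auto intro: le_less_trans)
  have hg_int: "integrable lborel (\<lambda>z. h z * g z)"
    using Bochner_Integration.integrable_diff[OF gg_int diff_int] by simp
  have "ennreal \<bar>\<integral>z. g z * g z - h z * g z \<partial>lborel\<bar> \<le> ennreal (8 * \<eta>)"
    using order_trans[OF integral_norm_bound_ennreal[OF diff_int]] total by simp
  then have "(\<integral>z. g z * g z - h z * g z \<partial>lborel) \<le> 8 * \<eta>"
    using eta by simp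
  then have "(\<integral>z. g z * g z \<partial>lborel) \<le> (\<integral>z. h z * g z \<partial>lborel) + 8 * \<eta>"
    using gg_int hg_int by simp
  \<comment> \<open>As g takes only the values -1, 0 and 1, its square is the indicator of the
    symmetric difference.\<close>
  moreover have "(\<integral>z. g z * g z \<partial>lborel) = nikodym_dist K L"
  proof -
    have "(\<integral>z. g z * g z \<partial>lborel) = (\<integral>z. indicator ((K - L) \<union> (L - K)) z \<partial>lborel)"
      by (intro Bochner_Integration.integral_cong) (auto simp: g_def indicator_def)
    then show ?thesis
      by (simp add: nikodym_dist_def)
  qed
  ultimately show ?thesis
    by (simp add: h_def)
qed

section \<open>Conclusion with explicit constants\<close>

lemma integrable_moment:
  fixes K :: "(real \<times> real) set"
  assumes "compact K"
  shows "integrable lborel (\<lambda>w. fst w ^ i * snd w ^ j * indicator K w)"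
  using borel_integrable_compact[OF assms, of "\<lambda>w. fst w ^ i * snd w ^ j"]
  by (simp add: continuous_intros mult.commute)

text \<open>The polynomial kernel is inserted in the smoothing bound: the moment form gives the
  first term, and 8 \<eta> with \<eta> = 512 / (n + 1) gives the second.\<close>

lemma nikodym_dist_le_moments:
  fixes K L :: "(real \<times> real) set"
  assumes K: "compact K" "convex K" "K \<subseteq> {0..1} \<times> {0..1}"
    and L: "compact L" "convex L" "L \<subseteq> {0..1} \<times> {0..1}"
    and moments: "\<And>i j. i \<le> n \<Longrightarrow> j \<le> n \<Longrightarrow> \<bar>geometric_moment i j K - geometric_moment i j L\<bar> \<le> \<epsilon>"
  shows "nikodym_dist K L \<le> 419904 * 19 ^ n * \<epsilon>\<^sup>2 + 4096 / (real n + 1)"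
proof -
  define g where "g z = (indicator K z - indicator L z :: real)" for z
  obtain p :: "real poly" where p: "degree p \<le> n" "\<And>s. poly p s \<ge> 0"
    "(\<integral>\<^sup>+s. ennreal (poly p s) * indicator {-1..1} s \<partial>lborel) = 1"
    "(\<integral>\<^sup>+s. ennreal (\<bar>s\<bar> * poly p s) * indicator {-1..1} s \<partial>lborel) \<le> ennreal (512 / (real n + 1))"
    "(coeff_norm p)\<^sup>2 \<le> 419904 * 19 ^ n"
    by (rule polynomial_kernel[of n]) blast
  have "integrable lborel (\<lambda>w. fst w ^ i * snd w ^ j * g w)" for i j
    using K L integrable_moment[of K i j] integrable_moment[of L i j]
    by (simp add: g_def right_diff_distrib)
  moreover have "(\<integral>w. fst w ^ i * snd w ^ j * g w \<partial>lborel) = geometric_moment i j K - geometric_moment i j L" for i j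
    using K L integrable_moment[of K i j] integrable_moment[of L i j]
    by (simp add: g_def left_diff_distrib geometric_moment_def set_lebesgue_integral_def mult.commute)
  ultimately have "\<bar>\<integral>z. (\<integral>w. poly p (fst z - fst w) * poly p (snd z - snd w) * g w \<partial>lborel) * g z \<partial>lborel\<bar>
      \<le> (coeff_norm p)\<^sup>2 * \<epsilon>\<^sup>2"
    using moments p(1) by (intro moment_form_le) auto
  also have "\<dots> \<le> 419904 * 19 ^ n * \<epsilon>\<^sup>2"
    using p(5) by (intro mult_right_mono) auto
  finally show ?thesis
    using nikodym_dist_le[OF K L p(2,3,4)] by (simp add: g_def)
qed

theorem theorem4p2:
  shows "\<exists>a0 a1 :: real. a0 > 0 \<and> a1 > 0 \<and>
    (\<forall>(N::nat) (\<epsilon>::real) (K :: (real \<times> real) set) (L :: (real \<times> real) set).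
      \<epsilon> \<ge> 0 \<longrightarrow>
      convex_body K \<longrightarrow> convex_body L \<longrightarrow>
      K \<subseteq> {0..1} \<times> {0..1} \<longrightarrow> L \<subseteq> {0..1} \<times> {0..1} \<longrightarrow>
      (\<Sum>i=0..N. \<Sum>j=0..N. \<bar>geometric_moment i j K - geometric_moment i j L\<bar>\<^sup>2) \<le> \<epsilon>\<^sup>2 \<longrightarrow>
      nikodym_dist K L \<le>
        Min ((\<lambda>n::nat. a0 * (real n + 1)\<^sup>2 * exp (7 * (real n + 1)) * \<epsilon>\<^sup>2 + a1 / (real n + 1)) ` {0..N}))"
proof (rule exI[of _ 419904], rule exI[of _ 4096], intro conjI allI impI)
  fix N :: nat and \<epsilon> :: real and K L :: "(real \<times> real) set"
  assume eps: "\<epsilon> \<ge> 0" and body: "convex_body K" "convex_body L"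
    and sub: "K \<subseteq> {0..1} \<times> {0..1}" "L \<subseteq> {0..1} \<times> {0..1}"
    and close: "(\<Sum>i=0..N. \<Sum>j=0..N. \<bar>geometric_moment i j K - geometric_moment i j L\<bar>\<^sup>2) \<le> \<epsilon>\<^sup>2"
  \<comment> \<open>A single summand is at most the whole sum, and \<epsilon> \<ge> 0 allows the
    square root to be taken.\<close>
  have bound: "\<bar>geometric_moment i j K - geometric_moment i j L\<bar> \<le> \<epsilon>" if "i \<le> N" "j \<le> N" for i j
  proof -
    have "\<bar>geometric_moment i j K - geometric_moment i j L\<bar>\<^sup>2
        \<le> (\<Sum>j=0..N. \<bar>geometric_moment i j K - geometric_moment i j L\<bar>\<^sup>2)"
      using that by (intro member_le_sum) auto
    also have "\<dots> \<le> (\<Sum>i=0..N. \<Sum>j=0..N. \<bar>geometric_moment i j K - geometric_moment i j L\<bar>\<^sup>2)"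
      using that by (intro member_le_sum[where f = "\<lambda>i. \<Sum>j=0..N. \<bar>geometric_moment i j K - geometric_moment i j L\<bar>\<^sup>2"] sum_nonneg) auto
    also note close
    finally show ?thesis
      using eps by (rule power2_le_imp_le)
  qed
  have "nikodym_dist K L \<le> 419904 * (real n + 1)\<^sup>2 * exp (7 * (real n + 1)) * \<epsilon>\<^sup>2 + 4096 / (real n + 1)"
    if "n \<le> N" for n
  proof -
    \<comment> \<open>Since e \<ge> 2, 19 \<le> 2^7 \<le> e^7, which converts 19^n into the stated
      exponential.\<close>
    have "(19::real) \<le> 2 ^ 7"
      by simp
    also have "\<dots> \<le> exp 1 ^ 7"
      using exp_ge_add_one_self[of 1] by (intro power_mono) auto
    also have "\<dots> = exp 7"
      by (simp flip: exp_of_nat_mult)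
    finally have "(19::real) ^ n \<le> exp 7 ^ n"
      by (intro power_mono) auto
    also have "\<dots> = exp (7 * real n)"
      by (simp add: mult.commute flip: exp_of_nat_mult)
    also have "\<dots> \<le> 1 * exp (7 * (real n + 1))"
      by simp
    also have "\<dots> \<le> (real n + 1)\<^sup>2 * exp (7 * (real n + 1))"
      by (intro mult_right_mono) auto
    finally have "419904 * 19 ^ n * \<epsilon>\<^sup>2 \<le> 419904 * (real n + 1)\<^sup>2 * exp (7 * (real n + 1)) * \<epsilon>\<^sup>2"
      by (intro mult_right_mono) auto
    moreover have "nikodym_dist K L \<le> 419904 * 19 ^ n * \<epsilon>\<^sup>2 + 4096 / (real n + 1)"
      using body sub bound that by (intro nikodym_dist_le_moments) (auto simp: convex_body_def)
    ultimately show ?thesis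
      by linarith
  qed
  then show "nikodym_dist K L \<le>
      Min ((\<lambda>n::nat. 419904 * (real n + 1)\<^sup>2 * exp (7 * (real n + 1)) * \<epsilon>\<^sup>2 + 4096 / (real n + 1)) ` {0..N})"
    by (subst Min_ge_iff) auto
qed auto

end
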